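(* For all $n$, \[\mathrm{ex}(n,TT_4^-) = n \left\lfloor \frac{n-1}{2} \right\rfloor \left\lceil \frac{n-1}{2} \right\rceil,\] where $TT_4^-$ is the graph with vertex set $\{a,b,c,d\}$ and edge set $\{ab\to d,\ bc\to d,\ ac\to d\}$.
   Context: A $2\to1$ directed hypergraph (here simply a "graph") is a pair $H=(V,E)$ with $V$ a finite vertex set and $E$ a set of edges, each edge being a 3-element subset $\{a,b,c\}$ of $V$ with one element marked as the head; the edge with underlying set $\{a,b,c\}$ and head $c$ is written $ab \to c$. A triple of vertices may carry up to three distinct edges (one for each choice of head). A homomorphism $\phi:F\to G$ is a map $V(F)\to V(G)$ with $ab\to c\in E(F)\Rightarrow \phi(a)\phi(b)\to\phi(c)\in E(G)$. $G$ is $F$-free if there is no injective homomorphism $F\to G$. $\mathrm{ex}(n,F)$ is the maximum number of edges of an $F$-free graph on $n$ vertices. *)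

theory Defs
  imports Complex_Main
begin

text \<open>
  A directed edge is a pair of its underlying triple and its head, so a triple may carry up to
  three edges.
\<close>

type_synonym 'a dedge = "'a set \<times> 'a"

record 'a dgraph =
  verts :: "'a set"
  dedges :: "'a dedge set"

definition arrow :: "'a \<Rightarrow> 'a \<Rightarrow> 'a \<Rightarrow> 'a dedge"  (\<open>_ _ \<rightarrow>\<^sub>e _\<close> [1000, 1000, 1000] 60)
  where "a b \<rightarrow>\<^sub>e c = ({a, b, c}, c)"

definition is_dgraph :: "'a dgraph \<Rightarrow> bool" where
  "is_dgraph H \<longleftrightarrow> finite (verts H) \<and>
     (\<forall>(T, h) \<in> dedges H. T \<subseteq> verts H \<and> card T = 3 \<and> h \<in> T)"

definition dgraph_hom :: "('a \<Rightarrow> 'b) \<Rightarrow> 'a dgraph \<Rightarrow> 'b dgraph \<Rightarrow> bool" where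
  "dgraph_hom \<phi> F G \<longleftrightarrow> \<phi> ` verts F \<subseteq> verts G \<and>
     (\<forall>a b c. (a b \<rightarrow>\<^sub>e c) \<in> dedges F \<longrightarrow> ((\<phi> a) (\<phi> b) \<rightarrow>\<^sub>e (\<phi> c)) \<in> dedges G)"

definition dgraph_free :: "'a dgraph \<Rightarrow> 'b dgraph \<Rightarrow> bool" where
  "dgraph_free F G \<longleftrightarrow> \<not> (\<exists>\<phi>. dgraph_hom \<phi> F G \<and> inj_on \<phi> (verts F))"

text \<open>
  Every finite graph has an isomorphic copy with natural numbers as vertices, so it suffices to
  range over those.
\<close>

definition free_edge_counts :: "nat \<Rightarrow> 'a dgraph \<Rightarrow> nat set" where
  "free_edge_counts n F =
     {card (dedges G) | G :: nat dgraph. is_dgraph G \<and> card (verts G) = n \<and> dgraph_free F G}"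

definition ex_num :: "nat \<Rightarrow> 'a dgraph \<Rightarrow> nat" where
  "ex_num n F = Max (free_edge_counts n F)"

datatype vertex4 = va | vb | vc | vd

definition TT4_minus :: "vertex4 dgraph" where
  "TT4_minus = \<lparr>verts = {va, vb, vc, vd}, dedges = {va vb \<rightarrow>\<^sub>e vd, vb vc \<rightarrow>\<^sub>e vd, va vc \<rightarrow>\<^sub>e vd}\<rparr>"

lemma is_dgraph_TT4_minus: "is_dgraph TT4_minus"
  by (auto simp: is_dgraph_def TT4_minus_def arrow_def)

text \<open>The maximum is taken over a finite nonempty set as soon as the forbidden graph has an edge.\<close>

lemma finite_free_edge_counts: "finite (free_edge_counts n F)"
proof (rule finite_subset)
  show "free_edge_counts n F \<subseteq> {..2 ^ n * n}"
  proof
    fix k assume "k \<in> free_edge_counts n F"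
    then obtain G :: "nat dgraph" where G: "is_dgraph G" "card (verts G) = n" "k = card (dedges G)"
      by (auto simp: free_edge_counts_def)
    then have "dedges G \<subseteq> Pow (verts G) \<times> verts G" and fin: "finite (verts G)"
      by (auto simp: is_dgraph_def)
    then have "card (dedges G) \<le> card (Pow (verts G) \<times> verts G)"
      by (intro card_mono) auto
    with G fin show "k \<in> {..2 ^ n * n}"
      by (simp add: card_cartesian_product card_Pow)
  qed
qed simp

lemma free_edge_counts_nonempty:
  assumes "(a b \<rightarrow>\<^sub>e c) \<in> dedges F"
  shows "free_edge_counts n F \<noteq> {}"
proof -
  let ?G = "\<lparr>verts = {..<n}, dedges = {}\<rparr> :: nat dgraph"
  have "is_dgraph ?G" "card (verts ?G) = n" "dgraph_free F ?G"
    using assms by (auto simp: is_dgraph_def dgraph_free_def dgraph_hom_def)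
  then show ?thesis
    unfolding free_edge_counts_def by blast
qed

end

theory Submission
  imports Defs
begin

text \<open>
  A copy of \<open>TT\<^sub>4\<^sup>-\<close> with head \<open>d\<close> is a triangle in the link of \<open>d\<close>, the graph of all pairs \<open>P\<close>
  for which \<open>P \<union> {d}\<close> carries an edge with head \<open>d\<close>. The links of different vertices do not
  interact, so the number of edges is maximised by making every link an extremal triangle-free
  graph on the other \<open>n - 1\<close> vertices, and the value is given by Mantel's theorem.
\<close>

definition triangle_free :: "'a set set \<Rightarrow> bool" where
  "triangle_free E \<longleftrightarrow> \<not> (\<exists>x y z. {x, y} \<in> E \<and> {y, z} \<in> E \<and> {x, z} \<in> E)"

text \<open>Because d lies outside P, the pair can be recovered from its edge as T - {d}, so edges
  with head d correspond exactly to members of the link.\<close>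

definition link :: "'a dgraph \<Rightarrow> 'a \<Rightarrow> 'a set set" where
  "link G d = {P. d \<notin> P \<and> (insert d P, d) \<in> dedges G}"

text \<open>
  Mantel's theorem by removing both endpoints of an edge \<open>{x, y}\<close>: every other vertex is adjacent
  to at most one of them.
\<close>

lemma mantel:
  assumes "finite V" "E \<subseteq> Pow V" "\<And>e. e \<in> E \<Longrightarrow> card e = 2" "triangle_free E"
  shows "card E \<le> (card V div 2) * ((card V + 1) div 2)"
  using assms
proof (induction "card V" arbitrary: V E rule: less_induct)
  case less
  show ?case
  proof (cases "E = {}")
    case False
    then obtain x y where xy: "{x, y} \<in> E" "x \<noteq> y"
      using less.prems(3) by (metis card_2_iff ex_in_conv)
    let ?W = "V - {x, y}"
    define E' where "E' = {e \<in> E. e \<inter> {x, y} = {}}"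
    \<comment> \<open>For an outside vertex z joined to x or y, \<open>g z\<close> is the only such
      edge. For other z the value is not an edge, which is harmless since the image is used only for
      an upper bound.\<close>
    define g where "g z = (if {x, z} \<in> E then {x, z} else {y, z})" for z
    have finE: "finite E"
      using less.prems(1,2) by (meson finite_Pow_iff finite_subset)
    have sub: "{x, y} \<subseteq> V"
      using less.prems(2) xy(1) by blast
    then have cV: "card V = card ?W + 2"
      using less.prems(1) xy(2) card_Diff_subset[of "{x, y}" V] card_mono[of V "{x, y}"] by simp
    have "E - E' \<subseteq> insert {x, y} (g ` ?W)"
    proof
      fix e assume e: "e \<in> E - E'"
      then obtain u z where uz: "e = {u, z}" "u \<in> {x, y}" "u \<noteq> z"
        using less.prems(3)[of e] unfolding E'_def card_2_iff by auto
      show "e \<in> insert {x, y} (g ` ?W)"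
      proof (cases "z \<in> {x, y}")
        case True
        then show ?thesis using uz by auto
      next
        case False
        then have "z \<in> ?W" using e uz less.prems(2) by auto
        moreover have "\<not> ({x, z} \<in> E \<and> {y, z} \<in> E)"
          using less.prems(4) xy(1) unfolding triangle_free_def by blast
        then have "g z = e"
          using e uz(1,2) unfolding g_def by auto
        ultimately show ?thesis by blast
      qed
    qed
    then have "card (E - E') \<le> card (insert {x, y} (g ` ?W))"
      using less.prems(1) by (intro card_mono) auto
    also have "\<dots> \<le> Suc (card ?W)"
      using less.prems(1) card_image_le[of ?W g] by (simp add: card_insert_if le_SucI)
    finally have 1: "card (E - E') \<le> Suc (card ?W)" .
    have 2: "card E' \<le> (card ?W div 2) * ((card ?W + 1) div 2)"
    proof (rule less.hyps)
      show "E' \<subseteq> Pow ?W" using less.prems(2) unfolding E'_def by auto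
      show "triangle_free E'" using less.prems(4) by (auto simp: triangle_free_def E'_def)
    qed (use cV less.prems in \<open>auto simp: E'_def\<close>)
    have "E' \<subseteq> E" by (auto simp: E'_def)
    then have "card E = card E' + card (E - E')"
      using finE by (metis card_Diff_subset card_mono finite_subset le_add_diff_inverse)
    also have "\<dots> \<le> (card ?W div 2) * ((card ?W + 1) div 2) + Suc (card ?W)"
      using 1 2 by simp
    also have "\<dots> = (card ?W div 2) * ((card ?W + 1) div 2)
        + (card ?W div 2 + (card ?W + 1) div 2 + 1)"
      by simp
    \<comment> \<open>Two more vertices raise both halves by one, and (p + 1)(q + 1) = pq + (p + q +
      1), where p + q is the size of \<open>?W\<close>.\<close>
    also have "\<dots> = (card V div 2) * ((card V + 1) div 2)"
      unfolding cV by (simp add: algebra_simps)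
    finally show ?thesis .
  qed simp
qed

lemma link_triangle_free:
  assumes "is_dgraph G" "dgraph_free TT4_minus G"
  shows "triangle_free (link G d)"
  unfolding triangle_free_def
proof
  assume "\<exists>x y z. {x, y} \<in> link G d \<and> {y, z} \<in> link G d \<and> {x, z} \<in> link G d"
  then obtain x y z where "{x, y} \<in> link G d" "{y, z} \<in> link G d" "{x, z} \<in> link G d"
    by blast
  then have nd: "d \<notin> {x, y, z}" and e: "(x y \<rightarrow>\<^sub>e d) \<in> dedges G" "(y z \<rightarrow>\<^sub>e d) \<in> dedges G"
      "(x z \<rightarrow>\<^sub>e d) \<in> dedges G"
    by (auto simp: link_def arrow_def insert_commute)
  \<comment> \<open>Underlying triples have three elements, so the three link pairs are genuine
    pairs. This makes x, y, z distinct and the map below injective.\<close>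
  have tri: "{p, q, d} \<subseteq> verts G \<and> p \<noteq> q" if "(p q \<rightarrow>\<^sub>e d) \<in> dedges G" for p q
  proof -
    have "{p, q, d} \<subseteq> verts G" "card {p, q, d} = 3"
      using that assms(1) unfolding is_dgraph_def arrow_def by auto
    then show ?thesis by (auto simp: card_insert_if split: if_splits)
  qed
  define \<phi> where "\<phi> v = (case v of va \<Rightarrow> x | vb \<Rightarrow> y | vc \<Rightarrow> z | vd \<Rightarrow> d)" for v
  have "inj_on \<phi> (verts TT4_minus)"
    using nd e[THEN tri] by (auto simp: inj_on_def TT4_minus_def \<phi>_def)
  moreover have "dgraph_hom \<phi> TT4_minus G"
    unfolding dgraph_hom_def
  proof (intro conjI allI impI)
    show "\<phi> ` verts TT4_minus \<subseteq> verts G"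
      using e[THEN tri] by (auto simp: TT4_minus_def \<phi>_def)
    fix a b c assume "(a b \<rightarrow>\<^sub>e c) \<in> dedges TT4_minus"
    \<comment> \<open>\<open>arrow\<close> does not record the order of its tails, so a and b may be
      swapped against the listed edge. Comparing images of the whole triple avoids treating the
      orders separately.\<close>
    then obtain p q where pq: "{a, b, c} = {p, q, vd}" "c = vd" "p \<noteq> vd" "q \<noteq> vd"
        "(\<phi> p) (\<phi> q) \<rightarrow>\<^sub>e d \<in> dedges G"
      using e by (fastforce simp: TT4_minus_def arrow_def \<phi>_def)
    have "((\<phi> a) (\<phi> b) \<rightarrow>\<^sub>e (\<phi> c)) = (\<phi> ` {a, b, c}, d)"
      using pq(2) by (simp add: arrow_def \<phi>_def)
    also have "\<dots> = ((\<phi> p) (\<phi> q) \<rightarrow>\<^sub>e d)"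
      unfolding pq(1) by (simp add: arrow_def \<phi>_def)
    finally show "((\<phi> a) (\<phi> b) \<rightarrow>\<^sub>e (\<phi> c)) \<in> dedges G"
      using pq(5) by simp
  qed
  ultimately show False
    using assms(2) unfolding dgraph_free_def by blast
qed

text \<open>Converse of \<open>link_triangle_free\<close>, needed to check the extremal
  construction: a copy of \<open>TT4_minus\<close> puts a triangle into the link of the image of
  \<open>vd\<close>, and injectivity keeps that image out of the three pairs.\<close>

lemma dgraph_free_TT4_minusI:
  assumes "\<And>d. triangle_free (link G d)"
  shows "dgraph_free TT4_minus G"
  unfolding dgraph_free_def
proof (rule notI, elim exE conjE)
  fix \<phi> assume hom: "dgraph_hom \<phi> TT4_minus G" and inj: "inj_on \<phi> (verts TT4_minus)"
  have "{\<phi> p, \<phi> q} \<in> link G (\<phi> vd)"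
    if "(p q \<rightarrow>\<^sub>e vd) \<in> dedges TT4_minus" "p \<noteq> vd" "q \<noteq> vd" for p q
  proof -
    have "UNIV = verts TT4_minus"
      using vertex4.exhaust by (auto simp: TT4_minus_def)
    then have "\<phi> vd \<notin> {\<phi> p, \<phi> q}"
      using inj that(2,3) by (metis injD insertE singletonD)
    then show ?thesis
      using hom that(1) unfolding dgraph_hom_def link_def arrow_def
      by (auto simp: insert_commute[of "\<phi> vd"])
  qed
  then have "{\<phi> va, \<phi> vb} \<in> link G (\<phi> vd)" "{\<phi> vb, \<phi> vc} \<in> link G (\<phi> vd)"
      "{\<phi> va, \<phi> vc} \<in> link G (\<phi> vd)"
    by (simp_all add: TT4_minus_def)
  then show False
    using assms unfolding triangle_free_def by blast
qed

lemma card_dedges_le: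
  assumes G: "is_dgraph G" and free: "dgraph_free TT4_minus G"
  shows "card (dedges G) \<le> card (verts G) * ((card (verts G) - 1) div 2 * (card (verts G) div 2))"
proof -
  let ?V = "verts G"
  have fin: "finite ?V" using G by (simp add: is_dgraph_def)
  have link_Pow: "link G d \<subseteq> Pow (?V - {d})" for d
    using G by (auto simp: link_def is_dgraph_def)
  \<comment> \<open>Edges are grouped by head. Covering them by the disjoint union of all links is
    enough for an upper bound.\<close>
  have "dedges G \<subseteq> (\<lambda>(d, P). (insert d P, d)) ` (SIGMA d:?V. link G d)"
  proof
    fix e assume e: "e \<in> dedges G"
    obtain T h where [simp]: "e = (T, h)" by force
    have h: "h \<in> T" "T \<subseteq> ?V" using e G by (auto simp: is_dgraph_def)
    then have T: "insert h (T - {h}) = T" by blast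
    then have "T - {h} \<in> link G h" using e by (simp add: link_def)
    then show "e \<in> (\<lambda>(d, P). (insert d P, d)) ` (SIGMA d:?V. link G d)"
      using h T by (intro image_eqI[of _ _ "(h, T - {h})"]) auto
  qed
  moreover have finL: "finite (link G d)" for d
    using link_Pow fin by (meson finite_Diff finite_Pow_iff finite_subset)
  ultimately have "card (dedges G) \<le> card (SIGMA d:?V. link G d)"
    using fin by (intro surj_card_le) auto
  also have "\<dots> = (\<Sum>d\<in>?V. card (link G d))"
    using fin finL by simp
  also have "\<dots> \<le> (\<Sum>d\<in>?V. (card ?V - 1) div 2 * (card ?V div 2))"
  proof (rule sum_mono)
    fix d assume d: "d \<in> ?V"
    have "card P = 2" if "P \<in> link G d" for P
    proof -
      have "card (insert d P) = 3" "d \<notin> P"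
        using that G by (auto simp: link_def is_dgraph_def)
      moreover have "finite P"
        using that link_Pow fin by (meson PowD finite_Diff finite_subset subsetD)
      ultimately show ?thesis by simp
    qed
    then have "card (link G d) \<le> card (?V - {d}) div 2 * ((card (?V - {d}) + 1) div 2)"
      using fin link_Pow link_triangle_free[OF G free] by (intro mantel) auto
    \<comment> \<open>Positivity turns (n - 1) + 1 into n under truncated subtraction.\<close>
    moreover have "card (?V - {d}) = card ?V - 1" "card ?V > 0"
      using d fin by (auto simp: card_gt_0_iff)
    ultimately show "card (link G d) \<le> (card ?V - 1) div 2 * (card ?V div 2)" by simp
  qed
  finally show ?thesis by simp
qed

text \<open>For every d the other vertices are split as evenly as possible into \<open>A d\<close>
  and \<open>B d\<close>. The link of d becomes the complete bipartite graph between them, which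
  attains the bound in \<open>mantel\<close>.\<close>

lemma exists_extremal_dgraph:
  assumes fin: "finite V"
  shows "\<exists>G. is_dgraph G \<and> verts G = V \<and> dgraph_free TT4_minus G \<and>
    card (dedges G) = card V * ((card V - 1) div 2 * (card V div 2))"
proof -
  have "\<exists>A. A \<subseteq> V - {d} \<and> card A = (card V - 1) div 2" if "d \<in> V" for d
    using that fin by (metis card_Diff_singleton div_le_dividend obtain_subset_with_card_n)
  then obtain A where A: "A d \<subseteq> V - {d}" "card (A d) = (card V - 1) div 2" if "d \<in> V" for d
    by metis
  define B where "B d = V - {d} - A d" for d
  have cB: "card (B d) = card V div 2" if "d \<in> V" for d
  proof -
    have "card (B d) = card V - 1 - (card V - 1) div 2"
      using A[OF that] that fin by (simp add: B_def card_Diff_subset finite_subset)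
    moreover have "card V > 0" using that fin by (auto simp: card_gt_0_iff)
    ultimately show ?thesis by linarith
  qed
  let ?S = "SIGMA d:V. A d \<times> B d"
  define f where "f = (\<lambda>(d, a, b). a b \<rightarrow>\<^sub>e (d :: 'a))"
  define G where "G = \<lparr>verts = V, dedges = f ` ?S\<rparr>"
  have sep: "d \<notin> A d" "d \<notin> B d" "A d \<inter> B d = {}" if "d \<in> V" for d
    using A[OF that] by (auto simp: B_def)
  \<comment> \<open>The head of an edge gives d, and the disjoint classes \<open>A d\<close> and
    \<open>B d\<close> tell its two tails apart.\<close>
  have "inj_on f ?S"
  proof (rule inj_onI, clarsimp simp: f_def arrow_def)
    fix d a b a' b' assume *: "d \<in> V" "a \<in> A d" "b \<in> B d" "a' \<in> A d" "b' \<in> B d"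
      "{a, b, d} = {a', b', d}"
    have "a \<in> {a', b', d}" "b \<in> {a', b', d}" using *(6) by blast+
    then show "a = a' \<and> b = b'" using * sep[of d] by auto
  qed
  then have "card (dedges G) = card ?S"
    by (simp add: G_def card_image)
  also have "\<dots> = card V * ((card V - 1) div 2 * (card V div 2))"
  proof -
    have "finite (A d \<times> B d)" if "d \<in> V" for d
      using fin A(1)[OF that] by (auto simp: B_def intro: finite_subset)
    then show ?thesis
      using fin A(2) cB by (simp add: card_cartesian_product)
  qed
  finally have "card (dedges G) = card V * ((card V - 1) div 2 * (card V div 2))" .
  moreover have "is_dgraph G"
  proof -
    have "T \<subseteq> V \<and> card T = 3 \<and> h \<in> T" if Th: "(T, h) \<in> dedges G" for T h
    proof -
      obtain a b where ab: "h \<in> V" "a \<in> A h" "b \<in> B h" "T = {a, b, h}"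
        using Th by (auto simp: G_def f_def arrow_def)
      then have "a \<noteq> b" "a \<noteq> h" "b \<noteq> h" using sep[of h] by auto
      then show ?thesis using ab A(1)[of h] by (auto simp: B_def)
    qed
    moreover have "verts G = V" by (simp add: G_def)
    ultimately show ?thesis
      unfolding is_dgraph_def using fin by auto
  qed
  moreover have "dgraph_free TT4_minus G"
  proof (rule dgraph_free_TT4_minusI)
    fix d
    \<comment> \<open>Every pair in the link crosses between the two classes, so no three of them
      form a triangle.\<close>
    have *: "d \<in> V \<and> (x \<in> A d \<and> y \<in> B d \<or> x \<in> B d \<and> y \<in> A d)" if xy: "{x, y} \<in> link G d" for x y
    proof -
      obtain a b where ab: "d \<in> V" "a \<in> A d" "b \<in> B d" "insert d {x, y} = {a, b, d}" "d \<notin> {x, y}"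
        using xy by (simp add: link_def G_def f_def arrow_def image_iff) blast
      then have "a \<in> {x, y}" "b \<in> {x, y}" "a \<noteq> b" using sep[of d] by auto
      then show ?thesis using ab by auto
    qed
    show "triangle_free (link G d)"
      unfolding triangle_free_def using * sep(3)[of d] by (meson disjoint_iff)
  qed
  moreover have "verts G = V" by (simp add: G_def)
  ultimately show ?thesis by blast
qed

lemma ex_num_TT4_minus: "ex_num n TT4_minus = n * ((n - 1) div 2 * (n div 2))"
  unfolding ex_num_def
proof (rule Max_eqI[OF finite_free_edge_counts])
  show "k \<le> n * ((n - 1) div 2 * (n div 2))" if "k \<in> free_edge_counts n TT4_minus" for k
    using that card_dedges_le unfolding free_edge_counts_def by auto
  show "n * ((n - 1) div 2 * (n div 2)) \<in> free_edge_counts n TT4_minus"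
    using exists_extremal_dgraph[of "{..<n}"] unfolding free_edge_counts_def by force
qed

theorem theorem6:
  fixes n :: nat
  shows "int (ex_num n TT4_minus)
    = int n * \<lfloor>(real n - 1) / 2\<rfloor> * \<lceil>(real n - 1) / 2\<rceil>"
proof (cases n)
  \<comment> \<open>The case n = 0 stands apart because truncated \<open>n - 1\<close> is then 0
    while the real difference is -1. The factor n makes both sides zero.\<close>
  case (Suc m)
  have "\<lfloor>real m / 2\<rfloor> = int (m div 2)" "\<lceil>real m / 2\<rceil> = int (Suc m div 2)"
    by linarith+
  then show ?thesis by (simp add: ex_num_TT4_minus Suc distrib_right)
qed (simp add: ex_num_TT4_minus)

end
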